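(* Let $q$ be a prime power, let $G(V,E)$ be a finite directed or undirected graph with $V=\{1,\dots,n\}$, and let $f:\mathbb{F}_q^n\to\mathbb{F}_q^\ell$ be the encoding function of a linear index code for $G$ over $\mathbb{F}_q$. Then the null-space $\{\mathbf{x}\in\mathbb{F}_q^n : f(\mathbf{x})=0\}$ is a linear RDSS code for the same graph $G$.
   Context: For $i\in V$, let $N(i)=\{u\in V:(i,u)\in E\}$ (the out-neighbours of $i$ if $G$ is directed, the neighbours of $i$ if $G$ is undirected). For $X=(X_1,\dots,X_n)\in\mathbb{F}_q^n$ and $I\subseteq V$, $X_I\in\mathbb{F}_q^{|I|}$ denotes the projection onto the coordinates in $I$. An RDSS (recoverable distributed storage system) code for $G$ is a set $\mathcal{C}\subseteq\mathbb{F}_q^n$ for which there are deterministic recovery functions $f_i:\mathbb{F}_q^{|N(i)|}\to\mathbb{F}_q$, $i=1,\dots,n$, with $X_i=f_i(X_{N(i)})$ for all $X\in\mathcal{C}$ and all $i$. It is a linear RDSS code if $\mathcal{C}$ is a linear subspace and the $f_i$ can be taken to be linear over $\mathbb{F}_q$. An index code of length $\ell$ for $\mathbb{F}_q^n$ with side information graph $G$ consists of an encoding function $f:\mathbb{F}_q^n\to\mathbb{F}_q^\ell$ and decoding functions $g_1,\dots,g_n$ with $g_i(f(Y),Y_{N(i)})=Y_i$ for all $Y=(Y_1,\dots,Y_n)\in\mathbb{F}_q^n$ and all $i$. It is linear if $f$ and all the $g_i$ are linear over $\mathbb{F}_q$. *)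

theory Defs
  imports
    "Jordan_Normal_Form.VS_Connect"
    "Graph_Theory.Pair_Digraph"
    "HOL-Number_Theory.Prime_Powers"
begin

(* Directed and undirected graphs are treated uniformly: as usual in Graph_Theory, an undirected
   graph is a symmetric digraph (locale pair_sym_digraph), for which out-neighbours are neighbours.
   Loops are not excluded. *)
definition nbrs :: "'v pair_pre_digraph \<Rightarrow> 'v \<Rightarrow> 'v set" where
  "nbrs G i = {u \<in> pverts G. (i, u) \<in> parcs G}"

(* Vertices are numbered from 1, the entries of a vec from 0. *)
definition coord :: "'a vec \<Rightarrow> nat \<Rightarrow> 'a" where
  "coord X i = X $ (i - 1)"

(* The entries with index in I, listed by increasing index, as a vector of dimension card I. *)
definition proj :: "nat set \<Rightarrow> 'a vec \<Rightarrow> 'a vec" where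
  "proj I X = vec_of_list (map (coord X) (sorted_list_of_set I))"

(* The field as a vector space over itself. *)
definition scalar_space :: "('a::field, 'a) module" where
  "scalar_space =
    \<lparr>carrier = UNIV, monoid.mult = (*), one = 1, zero = 0, add = (+), module.smult = (*)\<rparr>"

definition recovery_functions ::
    "nat pair_pre_digraph \<Rightarrow> 'a vec set \<Rightarrow> (nat \<Rightarrow> 'a vec \<Rightarrow> 'a) \<Rightarrow> bool" where
  "recovery_functions G C f \<longleftrightarrow>
    (\<forall>X \<in> C. \<forall>i \<in> pverts G. coord X i = f i (proj (nbrs G i) X))"

definition rdss_code :: "nat \<Rightarrow> nat pair_pre_digraph \<Rightarrow> 'a vec set \<Rightarrow> bool" where
  "rdss_code n G C \<longleftrightarrow> C \<subseteq> carrier_vec n \<and> (\<exists>f. recovery_functions G C f)"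

definition linear_rdss_code :: "nat \<Rightarrow> nat pair_pre_digraph \<Rightarrow> 'a::field vec set \<Rightarrow> bool" where
  "linear_rdss_code n G C \<longleftrightarrow>
    rdss_code n G C \<and>
    VectorSpace.subspace class_ring C (module_vec TYPE('a) n) \<and>
    (\<exists>f. recovery_functions G C f \<and>
      (\<forall>i \<in> pverts G.
        linear_map class_ring (module_vec TYPE('a) (card (nbrs G i))) scalar_space (f i)))"

definition index_code ::
    "nat \<Rightarrow> nat \<Rightarrow> nat pair_pre_digraph \<Rightarrow> ('a vec \<Rightarrow> 'a vec) \<Rightarrow>
     (nat \<Rightarrow> 'a vec \<times> 'a vec \<Rightarrow> 'a) \<Rightarrow> bool" where
  "index_code n l G f g \<longleftrightarrow>
    f \<in> carrier_vec n \<rightarrow> carrier_vec l \<and>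
    (\<forall>Y \<in> carrier_vec n. \<forall>i \<in> pverts G. g i (f Y, proj (nbrs G i) Y) = coord Y i)"

(* Each decoding function is linear jointly in the codeword and the side information. *)
definition linear_index_code ::
    "nat \<Rightarrow> nat \<Rightarrow> nat pair_pre_digraph \<Rightarrow> ('a::field vec \<Rightarrow> 'a vec) \<Rightarrow>
     (nat \<Rightarrow> 'a vec \<times> 'a vec \<Rightarrow> 'a) \<Rightarrow> bool" where
  "linear_index_code n l G f g \<longleftrightarrow>
    index_code n l G f g \<and>
    linear_map class_ring (module_vec TYPE('a) n) (module_vec TYPE('a) l) f \<and>
    (\<forall>i \<in> pverts G.
      linear_map class_ring
        (direct_sum (module_vec TYPE('a) l) (module_vec TYPE('a) (card (nbrs G i))))
        scalar_space (g i))"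

end

theory Submission
  imports Defs
begin

lemma linear_map_compose:
  assumes S: "linear_map K U V S" and T: "linear_map K V W T"
  shows "linear_map K U W (T \<circ> S)"
proof -
  interpret S: linear_map K U V S by (fact S)
  interpret T: linear_map K V W T by (fact T)
  show ?thesis
  proof unfold_locales
    \<comment> \<open>The interpretations supply the vector space axioms for \<open>U\<close> and
      \<open>W\<close>; what remains is that \<open>T \<circ> S\<close> lies in
      \<open>module_hom\<close>.\<close>
    have "T (S x) \<in> carrier W" if "x \<in> carrier U" for x
      using that S.T_im T.T_im by blast
    then show "T \<circ> S \<in> LinearCombinations.module_hom K U W"
      unfolding LinearCombinations.module_hom_def using S.T_im by (simp add: Pi_iff)
  qed
qed

text \<open>On the null space the codeword is 0, so decoding from the side information alone, with the
  codeword fixed to 0, recovers each entry; this is the decoder composed with the injection of the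
  second summand.\<close>

theorem proposition1:
  fixes q n l :: nat
    and G :: "nat pair_pre_digraph"
    and f :: "'a::{field,finite} vec \<Rightarrow> 'a vec"
    and g :: "nat \<Rightarrow> 'a vec \<times> 'a vec \<Rightarrow> 'a"
  assumes "primepow q" and "card (UNIV :: 'a set) = q"
    and "pair_fin_digraph G" and "pverts G = {1..n}"
    and "linear_index_code n l G f g"
  shows "linear_rdss_code n G {x \<in> carrier_vec n. f x = 0\<^sub>v l}"
proof -
  let ?V = "module_vec TYPE('a)"
  let ?C = "{x \<in> carrier_vec n. f x = 0\<^sub>v l}"
  \<comment> \<open>\<open>inj2\<close> maps \<open>s\<close> to the pair \<open>(0, s)\<close>, so
    \<open>h i s\<close> is \<open>g i (0\<^sub>v l, s)\<close>.\<close>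
  define h where "h i = g i \<circ> inj2 (?V l) (?V (card (nbrs G i)))" for i
  have lin_f: "linear_map class_ring (?V n) (?V l) f"
    and lin_g: "\<And>i. i \<in> pverts G \<Longrightarrow>
      linear_map class_ring (direct_sum (?V l) (?V (card (nbrs G i)))) scalar_space (g i)"
    and decode: "\<And>Y i. Y \<in> carrier_vec n \<Longrightarrow> i \<in> pverts G \<Longrightarrow>
      g i (f Y, proj (nbrs G i) Y) = coord Y i"
    using assms(5) by (auto simp: linear_index_code_def index_code_def)
  interpret f: linear_map class_ring "?V n" "?V l" f by (fact lin_f)
  have "f.ker = ?C"
    by (simp add: f.ker_def module_vec_simps)
  then have "VectorSpace.subspace class_ring ?C (?V n)"
    using f.kerT_is_subspace by simp
  moreover have "linear_map class_ring (?V (card (nbrs G i))) scalar_space (h i)"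
    if "i \<in> pverts G" for i
    \<comment> \<open>Joint linearity of \<open>g i\<close> on the direct sum is what makes its
      restriction to the second summand linear.\<close>
    unfolding h_def by (rule linear_map_compose[OF inj2_linear[OF vec_vs vec_vs] lin_g[OF that]])
  moreover have "recovery_functions G ?C h"
    unfolding recovery_functions_def
  proof (intro ballI)
    fix X i assume "X \<in> ?C" and i: "i \<in> pverts G"
    then have "X \<in> carrier_vec n" "f X = 0\<^sub>v l"
      by auto
    \<comment> \<open>Since \<open>f X\<close> is zero, the pair fed to \<open>g i\<close> inside
      \<open>h i\<close> is exactly the one that \<open>decode\<close> speaks of.\<close>
    with decode[OF this(1) i] show "coord X i = h i (proj (nbrs G i) X)"
      by (simp add: h_def inj2_def module_vec_simps)
  qed
  \<comment> \<open>The same \<open>h\<close> witnesses both existentials: the one in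
    \<open>rdss_code\<close> and the linear one.\<close>
  ultimately show ?thesis
    unfolding linear_rdss_code_def rdss_code_def by blast
qed

end
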